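(* Let $n\ge 1$ be an integer, $0\le\alpha<2$ and $0\le\beta<n/2$. Let $(u_0,u_1)\in\dot H^{-\beta}(\mathbb R^n)\times\dot H^{-\beta}(\mathbb R^n)$ be (real-valued) functions satisfying, for some constant $c>0$, $$u_0(x)+u_1(x)\ \ge\ c\,\langle x\rangle^{-n\left(\frac12+\frac{\beta}{n}\right)}\big(\log(e+|x|)\big)^{-1},\qquad x\in\mathbb R^n.$$ Assume that $$1<p<p_{\rm c}(\alpha,\beta,n):=1+\frac{4-2\alpha}{n+2\beta}.$$ Then, for $\varepsilon>0$, there is no global weak solution in $\mathcal C([0,\infty),L^2)$ to $$\begin{cases}u_{tt}-\Delta u+u_t=|x|^{-\alpha}|u|^p, & x\in\mathbb R^n,\ t>0,\\ u(0,x)=\varepsilon u_0(x),\quad u_t(0,x)=\varepsilon u_1(x), & x\in\mathbb R^n.\end{cases}$$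
   Context: $\langle x\rangle:=\sqrt{1+|x|^2}$. The space $\dot H^{-\beta}$ consists of $\varphi\in\mathcal Z'=\mathcal S'/\mathcal P$ (tempered distributions modulo polynomials) with $\|\varphi\|_{\dot H^{-\beta}}:=\|\mathfrak F^{-1}(|\xi|^{-\beta}\widehat\varphi(\xi))\|_{L^2}<\infty$. Weak solutions: let $p>1$, $\alpha\ge0$, $T\in(0,\infty]$. A function $u\in\mathcal C([0,T),L^2)$ is a weak solution on $[0,T)$ (local if $T<\infty$, global if $T=\infty$) if for every $\phi(t,x)=\eta(t)\varphi(x)$ with $\eta\in\mathcal C_0^\infty([0,T))$ and $\varphi\in\mathcal C^\infty(\mathbb R^n)$ having all derivatives in $L^1\cap L^\infty$, $$\int_0^T\!\!\int_{\mathbb R^n}|x|^{-\alpha}|u|^p\phi\,dx\,dt=\int_0^T\!\!\int_{\mathbb R^n}(\partial_t^2-\Delta+\partial_t)u\;\phi\,dx\,dt,$$ where the right-hand side is understood after integration by parts using the initial conditions, i.e. (with the integrals well defined) $$\int_0^T\!\!\int_{\mathbb R^n}|x|^{-\alpha}|u|^p\phi\,dx\,dt+\varepsilon\int_{\mathbb R^n}(u_0+u_1)(x)\,\phi(0,x)\,dx-\varepsilon\int_{\mathbb R^n}u_0(x)\,\partial_t\phi(0,x)\,dx=\int_0^T\!\!\int_{\mathbb R^n}u\,(\partial_t^2-\Delta-\partial_t)\phi\,dx\,dt.$$ *)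

theory Defs
  imports "HOL-Analysis.Analysis"
begin

subsection \<open>Smooth functions on Euclidean space\<close>

definition partial_deriv ::
    "'n::finite \<Rightarrow> (real^'n \<Rightarrow> 'b::real_normed_vector) \<Rightarrow> real^'n \<Rightarrow> 'b" where
  "partial_deriv i f x = frechet_derivative f (at x) (axis i 1)"

definition iter_partial ::
    "'n::finite list \<Rightarrow> (real^'n \<Rightarrow> 'b::real_normed_vector) \<Rightarrow> real^'n \<Rightarrow> 'b" where
  "iter_partial is f = foldr partial_deriv is f"

definition smooth :: "(real^'n::finite \<Rightarrow> 'b::real_normed_vector) \<Rightarrow> bool" where
  "smooth f \<longleftrightarrow> (\<forall>is x. iter_partial is f differentiable (at x))"

definition laplacian :: "(real^'n::finite \<Rightarrow> real) \<Rightarrow> real^'n \<Rightarrow> real" where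
  "laplacian f x = (\<Sum>i\<in>UNIV. partial_deriv i (partial_deriv i f) x)"

definition compactly_supported :: "(real^'n::finite \<Rightarrow> 'b::real_normed_vector) \<Rightarrow> bool" where
  "compactly_supported f \<longleftrightarrow> (\<exists>R. \<forall>x. norm x > R \<longrightarrow> f x = 0)"

definition square_integrable :: "(real^'n::finite \<Rightarrow> 'b::euclidean_space) \<Rightarrow> bool" where
  "square_integrable f \<longleftrightarrow>
     f \<in> borel_measurable lebesgue \<and> integrable lebesgue (\<lambda>x. (norm (f x))\<^sup>2)"

definition L2_dist :: "(real^'n::finite \<Rightarrow> real) \<Rightarrow> (real^'n \<Rightarrow> real) \<Rightarrow> real" where
  "L2_dist f g = sqrt (LINT x|lebesgue. (f x - g x)\<^sup>2)"

definition japanese :: "real^'n::finite \<Rightarrow> real" where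
  "japanese x = sqrt (1 + (norm x)\<^sup>2)"

subsection \<open>Tempered distributions and the homogeneous Sobolev space\<close>

definition schwartz :: "(real^'n::finite \<Rightarrow> complex) \<Rightarrow> bool" where
  "schwartz f \<longleftrightarrow> smooth f \<and>
     (\<forall>k is. bounded (range (\<lambda>x. (norm x ^ k) *\<^sub>R iter_partial is f x)))"

definition schwartz_seminorm ::
    "nat \<Rightarrow> 'n::finite list \<Rightarrow> (real^'n \<Rightarrow> complex) \<Rightarrow> real" where
  "schwartz_seminorm k is f = (SUP x. norm x ^ k * norm (iter_partial is f x))"

text \<open>Distributions are represented by functionals on all functions, of which only the values on
  Schwartz functions are meaningful.  As the Schwartz space is metrizable, continuity is
  sequential continuity.\<close>

definition tempered :: "((real^'n::finite \<Rightarrow> complex) \<Rightarrow> complex) \<Rightarrow> bool" where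
  "tempered T \<longleftrightarrow>
     (\<forall>f g. schwartz f \<longrightarrow> schwartz g \<longrightarrow> T (\<lambda>x. f x + g x) = T f + T g) \<and>
     (\<forall>a f. schwartz f \<longrightarrow> T (\<lambda>x. a * f x) = a * T f) \<and>
     (\<forall>F. (\<forall>j::nat. schwartz (F j)) \<longrightarrow>
          (\<forall>k is. (\<lambda>j. schwartz_seminorm k is (F j)) \<longlonglongrightarrow> 0) \<longrightarrow>
          (\<lambda>j. T (F j)) \<longlonglongrightarrow> 0)"

definition fourier :: "(real^'n::finite \<Rightarrow> complex) \<Rightarrow> real^'n \<Rightarrow> complex" where
  "fourier f \<xi> = of_real ((2 * pi) powr (- real CARD('n) / 2)) *
     (LINT x|lebesgue. exp (- (\<i> * of_real (x \<bullet> \<xi>))) * f x)"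

definition inv_fourier :: "(real^'n::finite \<Rightarrow> complex) \<Rightarrow> real^'n \<Rightarrow> complex" where
  "inv_fourier f x = of_real ((2 * pi) powr (- real CARD('n) / 2)) *
     (LINT \<xi>|lebesgue. exp (\<i> * of_real (x \<bullet> \<xi>)) * f \<xi>)"

definition fourier_distr ::
    "((real^'n::finite \<Rightarrow> complex) \<Rightarrow> complex) \<Rightarrow> (real^'n \<Rightarrow> complex) \<Rightarrow> complex" where
  "fourier_distr T \<psi> = T (fourier \<psi>)"

definition inv_fourier_distr ::
    "((real^'n::finite \<Rightarrow> complex) \<Rightarrow> complex) \<Rightarrow> (real^'n \<Rightarrow> complex) \<Rightarrow> complex" where
  "inv_fourier_distr T \<psi> = T (inv_fourier \<psi>)"

definition mult_distr ::
    "(real^'n::finite \<Rightarrow> real) \<Rightarrow> ((real^'n \<Rightarrow> complex) \<Rightarrow> complex) \<Rightarrow>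
     (real^'n \<Rightarrow> complex) \<Rightarrow> complex" where
  "mult_distr m T \<psi> = T (\<lambda>\<xi>. of_real (m \<xi>) * \<psi> \<xi>)"

text \<open>The space Z of Schwartz functions whose Fourier transform vanishes to infinite order at the
  origin.  Its dual is the space of tempered distributions modulo polynomials: two tempered
  distributions differ by a polynomial iff they agree on Z.\<close>

definition Z_space :: "(real^'n::finite \<Rightarrow> complex) \<Rightarrow> bool" where
  "Z_space \<psi> \<longleftrightarrow> schwartz \<psi> \<and> (\<forall>is. iter_partial is (fourier \<psi>) 0 = 0)"

text \<open>The class of \<open>T\<close> modulo polynomials lies in the homogeneous Sobolev space of order \<open>- \<beta>\<close>:
  the functional that takes \<open>\<psi>\<close> in Z to the pairing of \<open>\<psi>\<close> with the inverse transform of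
  \<open>|\<xi>|^(-\<beta>)\<close> times the transform of \<open>T\<close> is represented by an \<open>L^2\<close> function \<open>h\<close>, which is then unique
  and whose norm is the Sobolev norm.  Multiplication by \<open>|\<xi>|^(-\<beta>)\<close> preserves
  the Schwartz functions vanishing to infinite order at the origin, so \<open>T\<close> is evaluated at a
  Schwartz function here.\<close>

definition hom_sobolev_neg ::
    "real \<Rightarrow> ((real^'n::finite \<Rightarrow> complex) \<Rightarrow> complex) \<Rightarrow> bool" where
  "hom_sobolev_neg \<beta> T \<longleftrightarrow> tempered T \<and>
     (\<exists>h :: real^'n \<Rightarrow> complex. square_integrable h \<and>
       (\<forall>\<psi>. Z_space \<psi> \<longrightarrow>
          inv_fourier_distr (mult_distr (\<lambda>\<xi>. norm \<xi> powr (- \<beta>)) (fourier_distr T)) \<psi>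
            = (LINT x|lebesgue. h x * \<psi> x)))"

text \<open>The pairing with \<open>f\<close> is prescribed on compactly supported test functions only, which
  determines \<open>T\<close> by density; a tempered distribution may be a locally integrable function without
  its product with every Schwartz function being absolutely integrable.\<close>

definition fun_in_hom_sobolev_neg :: "real \<Rightarrow> (real^'n::finite \<Rightarrow> real) \<Rightarrow> bool" where
  "fun_in_hom_sobolev_neg \<beta> f \<longleftrightarrow>
     (\<forall>K. compact K \<longrightarrow> f absolutely_integrable_on K) \<and>
     (\<exists>T. hom_sobolev_neg \<beta> T \<and>
       (\<forall>\<psi>. smooth \<psi> \<and> compactly_supported \<psi> \<longrightarrow>
          T \<psi> = (LINT x|lebesgue. of_real (f x) * \<psi> x)))"

subsection \<open>Weak solutions\<close>

definition time_dom :: "ereal \<Rightarrow> real set" where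
  "time_dom T = {t. 0 \<le> t \<and> ereal t < T}"

text \<open>Time derivatives are taken within the time interval, hence are one-sided at \<open>t = 0\<close>.\<close>

definition time_deriv :: "ereal \<Rightarrow> (real \<Rightarrow> real) \<Rightarrow> real \<Rightarrow> real" where
  "time_deriv T \<eta> t = vector_derivative \<eta> (at t within time_dom T)"

definition time_test :: "ereal \<Rightarrow> (real \<Rightarrow> real) \<Rightarrow> bool" where
  "time_test T \<eta> \<longleftrightarrow>
     (\<forall>k. \<forall>t\<in>time_dom T. (time_deriv T ^^ k) \<eta> differentiable (at t within time_dom T)) \<and>
     (\<exists>R. ereal R < T \<and> (\<forall>t\<in>time_dom T. t > R \<longrightarrow> \<eta> t = 0))"

definition space_test :: "(real^'n::finite \<Rightarrow> real) \<Rightarrow> bool" where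
  "space_test \<phi> \<longleftrightarrow> smooth \<phi> \<and>
     (\<forall>is. integrable lebesgue (iter_partial is \<phi>) \<and> bounded (range (iter_partial is \<phi>)))"

definition continuous_L2 :: "ereal \<Rightarrow> (real \<Rightarrow> real^'n::finite \<Rightarrow> real) \<Rightarrow> bool" where
  "continuous_L2 T u \<longleftrightarrow>
     (\<forall>t\<in>time_dom T. square_integrable (u t)) \<and>
     (\<forall>s\<in>time_dom T. ((\<lambda>t. L2_dist (u t) (u s)) \<longlongrightarrow> 0) (at s within time_dom T))"

text \<open>Space-time integrals are iterated, so that they depend only on the \<open>L^2\<close> classes \<open>u t\<close>; no
  jointly measurable representative of \<open>u\<close> has to be chosen.\<close>

definition iter_integrable :: "ereal \<Rightarrow> (real \<Rightarrow> real^'n::finite \<Rightarrow> real) \<Rightarrow> bool" where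
  "iter_integrable T F \<longleftrightarrow>
     (AE t in lebesgue. t \<in> time_dom T \<longrightarrow> integrable lebesgue (F t)) \<and>
     set_integrable lebesgue (time_dom T) (\<lambda>t. LINT x|lebesgue. F t x)"

definition iter_integral :: "ereal \<Rightarrow> (real \<Rightarrow> real^'n::finite \<Rightarrow> real) \<Rightarrow> real" where
  "iter_integral T F = (LINT t:time_dom T|lebesgue. (LINT x|lebesgue. F t x))"

text \<open>Weak solutions on \<open>[0,T)\<close> of \<open>u_tt - \<Delta>u + u_t = |x|^(-\<alpha>) |u|^p\<close> with initial data
  \<open>\<epsilon> u0\<close>, \<open>\<epsilon> u1\<close>; the test function is \<open>\<eta>(t) \<phi>(x)\<close>.\<close>

definition weak_solution ::
    "real \<Rightarrow> real \<Rightarrow> ereal \<Rightarrow> real \<Rightarrow> (real^'n::finite \<Rightarrow> real) \<Rightarrow> (real^'n \<Rightarrow> real) \<Rightarrow>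
     (real \<Rightarrow> real^'n \<Rightarrow> real) \<Rightarrow> bool" where
  "weak_solution p \<alpha> T \<epsilon> u0 u1 u \<longleftrightarrow>
     continuous_L2 T u \<and>
     (\<forall>\<eta> \<phi>. time_test T \<eta> \<and> space_test \<phi> \<longrightarrow>
       (let source = (\<lambda>t x. norm x powr (- \<alpha>) * \<bar>u t x\<bar> powr p * (\<eta> t * \<phi> x));
            data = (\<lambda>x. (u0 x + u1 x) * (\<eta> 0 * \<phi> x));
            data' = (\<lambda>x. u0 x * (time_deriv T \<eta> 0 * \<phi> x));
            linear = (\<lambda>t x. u t x *
              (time_deriv T (time_deriv T \<eta>) t * \<phi> x - \<eta> t * laplacian \<phi> x
                - time_deriv T \<eta> t * \<phi> x))
        in iter_integrable T source \<and> integrable lebesgue data \<and> integrable lebesgue data' \<and>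
           iter_integrable T linear \<and>
           iter_integral T source + \<epsilon> * (LINT x|lebesgue. data x) - \<epsilon> * (LINT x|lebesgue. data' x)
             = iter_integral T linear))"

definition p_crit :: "real \<Rightarrow> real \<Rightarrow> nat \<Rightarrow> real" where
  "p_crit \<alpha> \<beta> n = 1 + (4 - 2 * \<alpha>) / (real n + 2 * \<beta>)"

end

theory Submission
  imports Defs "HOL-Real_Asymp.Real_Asymp"
begin

text \<open>The test function method.  Let \<open>\<eta>\<close> and \<open>\<phi>\<close> be cutoffs in \<open>t \<le> R\<^sup>2\<close> and \<open>|x| \<le> R\<close> with
  \<open>\<eta>'(0) = 0\<close>, built from \<open>exp (- 1 / y)\<close> so that
  \<open>|\<eta>'' \<phi> - \<eta> \<Delta>\<phi> - \<eta>' \<phi>| \<le> L R^(-2) (\<eta> \<phi>)^(1/p)\<close>.  Young's inequality absorbs the linear term of the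
  weak formulation into the source term, which leaves
  \<open>\<epsilon> \<integral> (u0 + u1) \<eta>(0) \<phi> \<le> C R^(n + 2 - 2p/(p-1) + \<alpha>/(p-1)) = C R^(n - (2-\<alpha>)/(p-1))\<close>.
  By the lower bound on the data the left side is at least of order \<open>R^(n/2 - \<beta>) / log R\<close>, which is
  the larger one for large \<open>R\<close> exactly when \<open>p\<close> is subcritical.\<close>

section \<open>The flat exponential and its derivatives\<close>

text \<open>Differentiating \<open>exp (- 1 / y)\<close> repeatedly produces only combinations of
  the functions \<open>exp (- 1 / y) / y ^ m\<close>, so the index \<open>m\<close> makes a family
  closed under differentiation.\<close>

definition flat_exp :: "nat \<Rightarrow> real \<Rightarrow> real" where
  "flat_exp m y = (if 0 < y then exp (- 1 / y) / y ^ m else 0)"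

lemma flat_exp_nonneg: "0 \<le> flat_exp m y"
  by (simp add: flat_exp_def)

lemma flat_exp_nonpos: "y \<le> 0 \<Longrightarrow> flat_exp m y = 0"
  by (simp add: flat_exp_def)

text \<open>Follows from \<open>(1 + z / m) ^ m \<le> exp z\<close> on dropping the summand 1. The
  case \<open>m = 0\<close> is separate because of the division; there
  \<open>0 ^ 0 = 1\<close>.\<close>

lemma power_le_exp:
  fixes z :: real
  assumes "0 \<le> z"
  shows "z ^ m \<le> real m ^ m * exp z"
proof (cases "m = 0")
  case False
  have "(z / m) ^ m \<le> (1 + z / m) ^ m"
    using assms by (intro power_mono) auto
  also have "\<dots> \<le> exp z"
    using assms False by (intro exp_ge_one_plus_x_over_n_power_n) auto
  finally show ?thesis
    using False by (simp add: power_divide field_simps)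
qed (use assms in auto)

text \<open>With \<open>z = 1 / y\<close> the claim is \<open>z ^ m * exp (- \<delta> * z) \<le> (m / \<delta>) ^ m\<close>.  It makes all derivatives
  of the cutoffs bounded by the \<open>1 / p\<close>-th power of the cutoffs themselves.\<close>

lemma flat_exp_le_powr:
  assumes "0 < \<delta>"
  shows "flat_exp m y \<le> (real m / \<delta>) ^ m * flat_exp 0 y powr (1 - \<delta>)"
proof (cases "0 < y")
  case True
  have "(\<delta> / y) ^ m \<le> real m ^ m * exp (\<delta> / y)"
    using assms True by (intro power_le_exp) auto
  then have "1 / y ^ m \<le> (real m / \<delta>) ^ m * exp (\<delta> / y)"
    using assms True by (simp add: power_divide field_simps)
  then have "exp (- 1 / y) * (1 / y ^ m) \<le> exp (- 1 / y) * ((real m / \<delta>) ^ m * exp (\<delta> / y))"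
    by (intro mult_left_mono) auto
  also have "\<dots> = (real m / \<delta>) ^ m * exp (- 1 / y + \<delta> / y)"
    by (simp add: mult_exp_exp)
  also have "- 1 / y + \<delta> / y = (1 - \<delta>) * (- 1 / y)"
    by (simp add: left_diff_distrib diff_divide_distrib)
  finally show ?thesis
    using True by (simp add: flat_exp_def powr_def)
qed (simp add: flat_exp_def)

lemma flat_exp_le_const: "flat_exp m y \<le> real m ^ m"
proof (cases "0 < y")
  case True
  \<comment> \<open>With \<delta> = 1 the right side contains the zeroth power of
    \<open>flat_exp 0 y\<close>, which is 1 because this value is positive here.\<close>
  then show ?thesis
    using flat_exp_le_powr[of 1 m y] by (simp add: flat_exp_def)
qed (simp add: flat_exp_def)

text \<open>For positive \<open>y\<close> one factor \<open>y\<close> can be split off against the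
  next index, whose function is bounded. The limit supplies the derivative at the origin, where the
  formula changes.\<close>

lemma tendsto_flat_exp_0: "(flat_exp m \<longlongrightarrow> 0) (at 0)"
proof (rule Lim_null_comparison)
  show "\<forall>\<^sub>F y in at 0. norm (flat_exp m y) \<le> real (Suc m) ^ Suc m * \<bar>y\<bar>"
  proof (intro always_eventually allI)
    fix y :: real
    show "norm (flat_exp m y) \<le> real (Suc m) ^ Suc m * \<bar>y\<bar>"
    proof (cases "0 < y")
      case True
      have "flat_exp m y = flat_exp (Suc m) y * y"
        using True by (simp add: flat_exp_def)
      also have "\<dots> \<le> real (Suc m) ^ Suc m * y"
        using True by (intro mult_right_mono flat_exp_le_const) auto
      finally show ?thesis
        using True flat_exp_nonneg[of m y] by simp
    next
      case False
      have "0 \<le> real (Suc m) ^ Suc m * \<bar>y\<bar>"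
        by (intro mult_nonneg_nonneg) auto
      then show ?thesis
        using False by (simp only: flat_exp_nonpos not_less norm_zero)
    qed
  qed
qed (auto intro!: tendsto_eq_intros)

lemma flat_exp_has_real_derivative:
  "(flat_exp m has_real_derivative flat_exp (m + 2) y - real m * flat_exp (m + 1) y) (at y)"
proof -
  consider "0 < y" | "y < 0" | "y = 0" by linarith
  then show ?thesis
  proof cases
    case 1
    \<comment> \<open>The split on \<open>m\<close> removes the exponent \<open>m - 1\<close> that
      comes from differentiating \<open>y ^ m\<close>.\<close>
    have "((\<lambda>y. exp (- 1 / y) / y ^ m) has_real_derivative
        flat_exp (m + 2) y - real m * flat_exp (m + 1) y) (at y)"
      using 1
      by (auto intro!: derivative_eq_intros simp: flat_exp_def)
        (cases m; simp add: field_simps power2_eq_square)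
    then show ?thesis
      by (rule has_field_derivative_transform_within_open[of _ _ _ "{0<..}"])
        (use 1 in \<open>auto simp: flat_exp_def\<close>)
  next
    case 2
    have "((\<lambda>y. 0) has_real_derivative
        flat_exp (m + 2) y - real m * flat_exp (m + 1) y) (at y)"
      using 2 by (simp add: flat_exp_nonpos)
    then show ?thesis
      by (rule has_field_derivative_transform_within_open[of _ _ _ "{..<0}"])
        (use 2 in \<open>auto simp: flat_exp_def\<close>)
  next
    case 3
    \<comment> \<open>Dividing by \<open>h\<close> raises the index by one. The equation also holds
      at \<open>h = 0\<close>, where division by zero gives 0.\<close>
    have "(\<lambda>h. (flat_exp m (0 + h) - flat_exp m 0) / h) = flat_exp (m + 1)"
      by (simp add: flat_exp_def fun_eq_iff)
    then show ?thesis
      using 3 tendsto_flat_exp_0[of "m + 1"] by (simp add: DERIV_def flat_exp_nonpos)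
  qed
qed

section \<open>Smooth compactly supported bumps\<close>

text \<open>Using \<open>x \<bullet> x\<close> instead of the norm keeps the argument polynomial,
  hence smooth at the origin. The support has radius \<open>1 / sqrt r\<close>.\<close>

definition bump :: "real \<Rightarrow> nat \<Rightarrow> real^'n::finite \<Rightarrow> real" where
  "bump r m x = flat_exp m (1 - r * (x \<bullet> x))"

lemma bump_has_derivative:
  "(bump r m has_derivative
     (\<lambda>h. - 2 * r * (x \<bullet> h) * (bump r (m + 2) x - real m * bump r (m + 1) x))) (at x)"
proof -
  have "((\<lambda>x. 1 - r * (x \<bullet> x)) has_derivative (\<lambda>h. - 2 * r * (x \<bullet> h))) (at x)"
    by (auto intro!: derivative_eq_intros simp: inner_commute algebra_simps)
  from diff_chain_at[OF this
      flat_exp_has_real_derivative[of m "1 - r * (x \<bullet> x)", unfolded has_field_derivative_def]]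
  show ?thesis
    by (simp add: o_def bump_def[abs_def] mult_ac)
qed

lemma partial_deriv_eq:
  "(f has_derivative f') (at x) \<Longrightarrow> partial_deriv i f x = f' (axis i 1)"
  unfolding partial_deriv_def using frechet_derivative_at by metis

text \<open>Closed under partial derivatives, unlike the bumps themselves.\<close>

inductive_set bump_algebra :: "real \<Rightarrow> (real^'n::finite \<Rightarrow> real) set" for r :: real where
  const: "(\<lambda>x. a) \<in> bump_algebra r"
| coord: "(\<lambda>x. x $ i) \<in> bump_algebra r"
| bump: "bump r m \<in> bump_algebra r"
| add: "f \<in> bump_algebra r \<Longrightarrow> g \<in> bump_algebra r \<Longrightarrow> (\<lambda>x. f x + g x) \<in> bump_algebra r"
| mult: "f \<in> bump_algebra r \<Longrightarrow> g \<in> bump_algebra r \<Longrightarrow> (\<lambda>x. f x * g x) \<in> bump_algebra r"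

lemma partial_deriv_coord: "partial_deriv i (\<lambda>x. x $ j) = (\<lambda>x. axis i (1::real) $ j)"
  by (rule ext, rule partial_deriv_eq) (rule bounded_linear_imp_has_derivative[OF bounded_linear_vec_nth])

lemma partial_deriv_bump:
  "partial_deriv i (bump r m) =
     (\<lambda>x. - 2 * r * x $ i * (bump r (m + 2) x - real m * bump r (m + 1) x))"
  by (rule ext, subst partial_deriv_eq[OF bump_has_derivative]) (simp add: inner_axis)

lemma bump_algebra_deriv:
  assumes "f \<in> bump_algebra r"
  shows "(\<forall>x. f differentiable (at x)) \<and> (\<forall>i. partial_deriv i f \<in> bump_algebra r)"
  using assms
proof induction
  case (const a)
  have "partial_deriv i (\<lambda>x. a) = (\<lambda>x. 0)" for i :: 'a
    by (rule ext, rule partial_deriv_eq) auto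
  then show ?case by (auto intro: bump_algebra.const)
next
  case (coord j)
  show ?case
    by (auto simp: partial_deriv_coord intro: bump_algebra.const
        bounded_linear_imp_differentiable bounded_linear_vec_nth)
next
  case (bump m)
  \<comment> \<open>The difference is rewritten as a sum with a constant factor, so that only the
    operations of \<open>bump_algebra\<close> occur.\<close>
  have "partial_deriv i (bump r m) =
     (\<lambda>x. ((- 2 * r) * x $ i) * (bump r (m + 2) x + (- real m) * bump r (m + 1) x))" for i :: 'a
    by (simp add: partial_deriv_bump)
  also have "\<dots> i \<in> bump_algebra r" for i
    by (intro bump_algebra.intros)
  finally show ?case
    using bump_has_derivative differentiable_def by blast
next
  case (add f g)
  have "partial_deriv i (\<lambda>x. f x + g x) = (\<lambda>x. partial_deriv i f x + partial_deriv i g x)" for i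
  proof
    fix x
    have "((\<lambda>x. f x + g x) has_derivative
        (\<lambda>h. frechet_derivative f (at x) h + frechet_derivative g (at x) h)) (at x)"
      using add.IH frechet_derivative_works by (intro has_derivative_add) blast+
    then show "partial_deriv i (\<lambda>x. f x + g x) x = partial_deriv i f x + partial_deriv i g x"
      by (simp add: partial_deriv_eq) (simp add: partial_deriv_def)
  qed
  then show ?case
    using add.IH by (auto intro: bump_algebra.add)
next
  case (mult f g)
  have "partial_deriv i (\<lambda>x. f x * g x) =
      (\<lambda>x. f x * partial_deriv i g x + partial_deriv i f x * g x)" for i
  proof
    fix x
    have "((\<lambda>x. f x * g x) has_derivative
        (\<lambda>h. f x * frechet_derivative g (at x) h + frechet_derivative f (at x) h * g x)) (at x)"
      using mult.IH frechet_derivative_works by (intro has_derivative_mult) blast+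
    then show "partial_deriv i (\<lambda>x. f x * g x) x = f x * partial_deriv i g x + partial_deriv i f x * g x"
      by (simp add: partial_deriv_eq) (simp add: partial_deriv_def)
  qed
  then show ?case
    using mult by (auto intro!: bump_algebra.add bump_algebra.mult)
qed

lemma iter_partial_Cons: "iter_partial (i # is) f = partial_deriv i (iter_partial is f)"
  by (simp add: iter_partial_def)

lemma iter_partial_Nil: "iter_partial [] f = f"
  by (simp add: iter_partial_def)

lemma smooth_bump: "smooth (bump r m)"
proof -
  have "iter_partial is (bump r m) \<in> bump_algebra r" for "is" :: "'a list"
    by (induction "is") (auto simp: iter_partial_Nil iter_partial_Cons bump_algebra.bump bump_algebra_deriv)
  then show ?thesis
    using bump_algebra_deriv unfolding smooth_def by blast
qed

text \<open>Openness lets each differentiation see a function that is zero on a whole neighbourhood.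
  Applied to the complement of a ball, this passes compact support on to all derivatives.\<close>

lemma iter_partial_eq_0_open:
  assumes "smooth f" "open U" "\<And>x. x \<in> U \<Longrightarrow> f x = 0" "x \<in> U"
  shows "iter_partial is f x = 0"
  using assms(4)
proof (induction "is" arbitrary: x)
  case (Cons i "is")
  have "((\<lambda>x. 0) has_derivative (\<lambda>h. 0)) (at x)"
    by simp
  then have "(iter_partial is f has_derivative (\<lambda>h. 0)) (at x)"
    by (rule has_derivative_transform_within_open[OF _ assms(2) Cons.prems]) (simp add: Cons.IH)
  then show ?case
    by (simp add: iter_partial_Cons partial_deriv_eq)
qed (simp add: iter_partial_Nil assms)

text \<open>Every iterated partial derivative is continuous and vanishes off one fixed ball;
  compactness of the ball yields both integrability and boundedness.\<close>

lemma space_test_compactly_supported: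
  fixes f :: "real^'n::finite \<Rightarrow> real"
  assumes "smooth f" "compactly_supported f"
  shows "space_test f"
  unfolding space_test_def
proof (intro conjI allI assms(1))
  fix "is" :: "'n list"
  from assms(2) obtain R where R: "f x = 0" if "norm x > R" for x
    unfolding compactly_supported_def by blast
  let ?g = "iter_partial is f" and ?B = "cball 0 R"
  have zero: "?g x = 0" if "x \<notin> ?B" for x
    by (rule iter_partial_eq_0_open[OF assms(1), of "- ?B"]) (use R that in auto)
  have cont: "continuous_on ?B ?g"
    using assms(1) unfolding smooth_def
    by (meson differentiable_imp_continuous_within continuous_at_imp_continuous_on)
  have "integrable lborel (\<lambda>x. indicator ?B x *\<^sub>R ?g x)"
    by (rule borel_integrable_compact[OF compact_cball cont])
  moreover have "(\<lambda>x. indicator ?B x *\<^sub>R ?g x) = ?g"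
    using zero by (auto simp: indicator_def fun_eq_iff)
  ultimately have "integrable lborel ?g" by simp
  then show "integrable lebesgue ?g"
    by (simp add: integrable_completion borel_measurable_integrable)
  have "bounded (?g ` ?B)"
    by (intro compact_imp_bounded compact_continuous_image cont compact_cball)
  moreover have "range ?g \<subseteq> insert 0 (?g ` ?B)"
    using zero by blast
  ultimately show "bounded (range ?g)"
    using bounded_insert bounded_subset by metis
qed

lemma bump_eq_0: "1 \<le> r * (x \<bullet> x) \<Longrightarrow> bump r m x = 0"
  by (simp add: bump_def flat_exp_nonpos)

lemma compactly_supported_bump:
  assumes "0 < r"
  shows "compactly_supported (bump r m :: real^'n::finite \<Rightarrow> real)"
proof -
  have "1 \<le> r * (x \<bullet> x)" if "norm x > 1 / sqrt r" for x :: "real^'n"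
  proof -
    have "(1 / sqrt r)\<^sup>2 \<le> (norm x)\<^sup>2"
      using that assms by (intro power_mono) auto
    then show ?thesis
      using assms by (simp add: power_divide power2_norm_eq_inner field_simps)
  qed
  then show ?thesis
    unfolding compactly_supported_def using bump_eq_0 by blast
qed

lemma space_test_bump: "0 < r \<Longrightarrow> space_test (bump r m)"
  by (intro space_test_compactly_supported smooth_bump compactly_supported_bump)

section \<open>Time cutoffs as restrictions to an axis\<close>

lemma time_dom_infty: "time_dom \<infinity> = {0..}"
  by (auto simp: time_dom_def)

lemma line_has_vector_derivative:
  assumes "f differentiable (at (t *\<^sub>R axis i 1))"
  shows "((\<lambda>t. f (t *\<^sub>R axis i 1)) has_vector_derivative partial_deriv i f (t *\<^sub>R axis i 1))
           (at t within S)"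
proof -
  let ?e = "axis i (1::real)"
  have "((\<lambda>t. t *\<^sub>R ?e) has_derivative (\<lambda>h. h *\<^sub>R ?e)) (at t)"
    by (auto intro!: derivative_eq_intros)
  from diff_chain_at[OF this] assms
  have "((\<lambda>t. f (t *\<^sub>R ?e)) has_derivative (\<lambda>h. frechet_derivative f (at (t *\<^sub>R ?e)) (h *\<^sub>R ?e))) (at t)"
    by (simp add: o_def frechet_derivative_works)
  moreover have "linear (frechet_derivative f (at (t *\<^sub>R ?e)))"
    using assms by (rule linear_frechet_derivative)
  ultimately show ?thesis
    by (auto simp: has_vector_derivative_def partial_deriv_def linear_cmul
        intro: has_derivative_at_withinI)
qed

text \<open>Restricting \<open>f\<close> to a coordinate axis turns spatial partial derivatives into time derivatives, so
  that the same bump family serves for the cutoffs in time and in space.\<close>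

lemma time_deriv_iter_line:
  fixes f :: "real^'n::finite \<Rightarrow> real"
  assumes "smooth f"
  shows "0 \<le> t \<Longrightarrow> (time_deriv \<infinity> ^^ k) (\<lambda>t. f (t *\<^sub>R axis i 1)) t
           = iter_partial (replicate k i) f (t *\<^sub>R axis i 1)"
    and "0 \<le> t \<Longrightarrow> ((time_deriv \<infinity> ^^ k) (\<lambda>t. f (t *\<^sub>R axis i 1)) has_vector_derivative
           iter_partial (replicate (Suc k) i) f (t *\<^sub>R axis i 1)) (at t within {0..})"
\<comment> \<open>The two claims feed each other: the derivative found at stage \<open>k\<close>
  identifies the time derivative of order \<open>k + 1\<close>, and this identity gives the
  derivative at stage \<open>k + 1\<close>.\<close>
proof (induction k arbitrary: t)
  case 0
  {
    case 1
    then show ?case by (simp add: iter_partial_Nil)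
  next
    case 2
    have "f differentiable (at x)" for x
      using assms iter_partial_Nil unfolding smooth_def by metis
    then show ?case
      by (simp add: iter_partial_Nil iter_partial_Cons line_has_vector_derivative)
  }
next
  case (Suc k)
  have eq: "(time_deriv \<infinity> ^^ Suc k) (\<lambda>t. f (t *\<^sub>R axis i 1)) t
      = iter_partial (replicate (Suc k) i) f (t *\<^sub>R axis i 1)" if "0 \<le> t" for t
  proof -
    \<comment> \<open>Derivatives within \<open>{0..}\<close> are unique only if the filter is
      nontrivial: it is the right-sided one at 0 and the full one at interior points.\<close>
    have "at t within {0..} \<noteq> bot"
      using that by (metis at_within_Ici_at_right trivial_limit_at_right_real
          at_within_interior interior_real_atLeast greaterThan_iff le_less trivial_limit_at)
    then show ?thesis
      using vector_derivative_within[OF _ Suc.IH(2)[OF that]]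
      by (simp add: time_deriv_def[of _ "(time_deriv \<infinity> ^^ k) _"] time_dom_infty)
  qed
  {
    case 1
    then show ?case by (rule eq)
  next
    case 2
    have "iter_partial (replicate (Suc k) i) f differentiable (at x)" for x
      using assms unfolding smooth_def by blast
    from line_has_vector_derivative[OF this]
    have D: "((\<lambda>t. iter_partial (replicate (Suc k) i) f (t *\<^sub>R axis i 1)) has_vector_derivative
        iter_partial (replicate (Suc (Suc k)) i) f (t *\<^sub>R axis i 1)) (at t within {0..})"
      unfolding replicate_Suc iter_partial_Cons .
    show ?case
      by (rule has_vector_derivative_transform[OF _ _ D]) (simp_all only: atLeast_iff 2 eq)
  }
qed

lemma time_test_line:
  fixes f :: "real^'n::finite \<Rightarrow> real"
  assumes "smooth f" "compactly_supported f"
  shows "time_test \<infinity> (\<lambda>t. f (t *\<^sub>R axis i 1))"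
  unfolding time_test_def
proof (intro conjI allI ballI)
  fix k t
  assume "t \<in> time_dom \<infinity>"
  then show "(time_deriv \<infinity> ^^ k) (\<lambda>t. f (t *\<^sub>R axis i 1)) differentiable at t within time_dom \<infinity>"
    using time_deriv_iter_line(2)[OF assms(1)]
    by (auto simp: time_dom_infty intro: differentiableI_vector)
next
  from assms(2) obtain R where "f x = 0" if "norm x > R" for x
    unfolding compactly_supported_def by blast
  then show "\<exists>R. ereal R < \<infinity> \<and> (\<forall>t\<in>time_dom \<infinity>. R < t \<longrightarrow> f (t *\<^sub>R axis i 1) = 0)"
    by (auto simp: time_dom_infty norm_axis_1 intro!: exI[of _ R])
qed

section \<open>Derivatives of the cutoffs bounded by powers of the cutoffs\<close>

lemma partial_deriv2_bump:
  "partial_deriv i (partial_deriv i (bump r 0)) x =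
     - 2 * r * bump r 2 x + 4 * (r * x $ i)\<^sup>2 * (bump r 4 x - 2 * bump r 3 x)"
proof -
  have eq: "partial_deriv i (bump r 0) = (\<lambda>x. - 2 * r * x $ i * bump r 2 x)"
    by (simp add: partial_deriv_bump numeral_2_eq_2)
  have "((\<lambda>x. x $ i) has_derivative (\<lambda>h. h $ i)) (at x)"
    by (rule bounded_linear_imp_has_derivative[OF bounded_linear_vec_nth])
  from has_derivative_mult[OF has_derivative_mult_right[OF this, of "- 2 * r"]
      bump_has_derivative[of r 2 x]]
  show ?thesis
    unfolding eq
    by (subst partial_deriv_eq, assumption) (simp add: numeral_eq_Suc inner_axis power2_eq_square algebra_simps)
qed

lemma bump_nonneg: "0 \<le> bump r m x"
  by (simp add: bump_def flat_exp_nonneg)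

text \<open>The indices up to 4 cover all terms of the derivatives of order at most two. The
  exponent \<open>1 / p\<close> is \<open>1 - \<delta>\<close> with
  \<open>\<delta> = 1 - 1 / p\<close>.\<close>

lemma bump_le_powr:
  assumes "1 < p"
  shows "\<exists>K>0. \<forall>m\<le>4. \<forall>r (x::real^'n::finite). bump r m x \<le> K * bump r 0 x powr (1 / p)"
proof -
  define \<delta> where "\<delta> = 1 - 1 / p"
  have \<delta>: "0 < \<delta>" using assms by (simp add: \<delta>_def)
  \<comment> \<open>The sum of nonnegative constants dominates each of them, and its term for
    \<open>m = 0\<close> equals 1, which makes \<open>K\<close> positive.\<close>
  define K where "K = (\<Sum>m\<le>4. (real m / \<delta>) ^ m)"
  have le: "(real m / \<delta>) ^ m \<le> K" if "m \<le> 4" for m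
    unfolding K_def using \<delta> that by (intro member_le_sum) auto
  have "0 < K" using le[of 0] by simp
  moreover have "bump r m x \<le> K * bump r 0 x powr (1 / p)" if "m \<le> 4" for m r and x :: "real^'n"
    using flat_exp_le_powr[OF \<delta>, of m "1 - r * (x \<bullet> x)"]
      mult_right_mono[OF le[OF that], of "bump r 0 x powr (1 / p)"]
    by (simp add: bump_def \<delta>_def)
  ultimately show ?thesis by blast
qed

text \<open>On the support \<open>r * (x $ i)\<^sup>2 \<le> 1\<close>, so the factor
  \<open>r * x $ i\<close> created by a differentiation is at most \<open>sqrt r\<close>; off the
  support everything vanishes. Thus each derivative gains a factor \<open>sqrt r\<close>.\<close>

lemma bump_derivs_le_powr:
  assumes "1 < p"
  shows "\<exists>K>0. \<forall>r\<ge>0. \<forall>(x::real^'n::finite) i.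
    bump r 0 x \<le> K * bump r 0 x powr (1 / p) \<and>
    \<bar>partial_deriv i (bump r 0) x\<bar> \<le> K * sqrt r * bump r 0 x powr (1 / p) \<and>
    \<bar>partial_deriv i (partial_deriv i (bump r 0)) x\<bar> \<le> K * r * bump r 0 x powr (1 / p)"
proof -
  obtain K where K: "0 < K"
    and le: "\<And>m r (x::real^'n). m \<le> 4 \<Longrightarrow> bump r m x \<le> K * bump r 0 x powr (1 / p)"
    using bump_le_powr[OF assms] by blast
  show ?thesis
  \<comment> \<open>The second derivative needs 14 = 2 + 4 * 3: the coefficient 2 of
    \<open>bump r 2\<close>, and the coefficient 4 times the bound 3 for
    \<open>bump r 4 x - 2 * bump r 3 x\<close>.\<close>
  proof (intro exI[of _ "14 * K"] conjI allI impI)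
    fix r :: real and x :: "real^'n" and i :: 'n
    assume r: "0 \<le> r"
    define B where "B = K * bump r 0 x powr (1 / p)"
    have B: "0 \<le> B" using K by (simp add: B_def)
    have le': "bump r m x \<le> B" if "m \<le> 4" for m
      using le[OF that] by (simp add: B_def)
    show "bump r 0 x \<le> 14 * K * bump r 0 x powr (1 / p)"
      using le'[of 0] B by (simp add: B_def)
    show "\<bar>partial_deriv i (bump r 0) x\<bar> \<le> 14 * K * sqrt r * bump r 0 x powr (1 / p)"
      and "\<bar>partial_deriv i (partial_deriv i (bump r 0)) x\<bar> \<le> 14 * K * r * bump r 0 x powr (1 / p)"
    proof (atomize(full), cases "1 \<le> r * (x \<bullet> x)")
      case True
      then show "\<bar>partial_deriv i (bump r 0) x\<bar> \<le> 14 * K * sqrt r * bump r 0 x powr (1 / p) \<and>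
        \<bar>partial_deriv i (partial_deriv i (bump r 0)) x\<bar> \<le> 14 * K * r * bump r 0 x powr (1 / p)"
        unfolding partial_deriv2_bump by (simp add: partial_deriv_bump bump_eq_0)
    next
      case False
      have "(x $ i)\<^sup>2 \<le> x \<bullet> x"
        using component_le_norm_cart[of x i]
        by (metis abs_le_square_iff abs_norm_cancel dot_square_norm)
      then have xi: "r * (x $ i)\<^sup>2 \<le> 1"
        using False mult_left_mono[OF _ r, of "(x $ i)\<^sup>2" "x \<bullet> x"] by linarith
      then have "(sqrt r * \<bar>x $ i\<bar>)\<^sup>2 \<le> 1\<^sup>2"
        using r by (simp add: power_mult_distrib)
      then have xi': "sqrt r * \<bar>x $ i\<bar> \<le> 1"
        by (rule power2_le_imp_le) simp
      have "\<bar>partial_deriv i (bump r 0) x\<bar> = 2 * sqrt r * (sqrt r * \<bar>x $ i\<bar>) * bump r 2 x"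
        using r bump_nonneg[of r 2 x] by (simp add: partial_deriv_bump abs_mult numeral_2_eq_2)
      also have "\<dots> \<le> 2 * sqrt r * 1 * B"
        using r xi' B by (intro mult_mono le' mult_nonneg_nonneg bump_nonneg) auto
      also have "\<dots> \<le> 14 * sqrt r * B"
        using r B by (intro mult_right_mono) auto
      finally have 1: "\<bar>partial_deriv i (bump r 0) x\<bar> \<le> 14 * K * sqrt r * bump r 0 x powr (1 / p)"
        by (simp add: B_def mult_ac)
      have "\<bar>bump r 4 x - 2 * bump r 3 x\<bar> \<le> 3 * B"
        using le'[of 4] le'[of 3] bump_nonneg[of r 4 x] bump_nonneg[of r 3 x] by auto
      then have "r * (r * (x $ i)\<^sup>2) * \<bar>bump r 4 x - 2 * bump r 3 x\<bar> \<le> r * 1 * (3 * B)"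
        using r xi by (intro mult_mono) auto
      moreover have "r * bump r 2 x \<le> r * B"
        using r le' by (intro mult_left_mono) auto
      moreover have "\<bar>partial_deriv i (partial_deriv i (bump r 0)) x\<bar>
          \<le> 2 * (r * bump r 2 x) + 4 * (r * (r * (x $ i)\<^sup>2) * \<bar>bump r 4 x - 2 * bump r 3 x\<bar>)"
        unfolding partial_deriv2_bump
        by (rule order.trans[OF abs_triangle_ineq])
          (use r bump_nonneg[of r 2 x] in \<open>simp add: abs_mult power_mult_distrib power2_eq_square[of r]\<close>)
      ultimately have "\<bar>partial_deriv i (partial_deriv i (bump r 0)) x\<bar> \<le> 14 * (r * B)"
        by simp
      then show "\<bar>partial_deriv i (bump r 0) x\<bar> \<le> 14 * K * sqrt r * bump r 0 x powr (1 / p) \<and>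
        \<bar>partial_deriv i (partial_deriv i (bump r 0)) x\<bar> \<le> 14 * K * r * bump r 0 x powr (1 / p)"
        using 1 by (simp add: B_def mult_ac)
    qed
  qed (use K in auto)
qed

section \<open>Pointwise control of the linear term\<close>

text \<open>Young's inequality with both constants relaxed to 1. Comparing \<open>b\<close> with
  \<open>a powr (p - 1)\<close> shows that one of the two summands alone suffices.\<close>

lemma mult_le_powr_add_powr:
  fixes a b p :: real
  assumes "0 \<le> a" "0 \<le> b" "1 < p"
  shows "a * b \<le> a powr p + b powr (p / (p - 1))"
proof (cases "b \<le> a powr (p - 1)")
  case True
  then have "a * b \<le> a * a powr (p - 1)"
    using assms by (intro mult_left_mono) auto
  also have "\<dots> = a powr p"
    using assms by (cases "a = 0") (auto simp: powr_mult_base)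
  finally show ?thesis
    using powr_ge_zero[of b "p / (p - 1)"] by linarith
next
  case False
  then have "(a powr (p - 1)) powr (1 / (p - 1)) \<le> b powr (1 / (p - 1))"
    using assms by (intro powr_mono2) auto
  then have "a \<le> b powr (1 / (p - 1))"
    using assms by (simp add: powr_powr)
  then have "a * b \<le> b powr (1 / (p - 1)) * b"
    using assms by (intro mult_right_mono) auto
  also have "\<dots> = b powr (p / (p - 1))"
  proof -
    have "1 / (p - 1) + 1 = p / (p - 1)"
      using assms by (simp add: field_simps)
    then show ?thesis
      using assms by (metis mult.commute powr_mult_base add.commute)
  qed
  finally show ?thesis
    using powr_ge_zero[of a p] by linarith
qed

text \<open>The weight is distributed as \<open>norm x powr (- \<alpha> / p)\<close> on the factor
  with \<open>v\<close> and its reciprocal on the other. The first power is then exactly the source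
  density, and the conjugate exponent turns \<alpha>/p into \<alpha>/(p-1). The reciprocals cancel
  only for \<open>x \<noteq> 0\<close>.\<close>

lemma weighted_young:
  fixes x :: "real^'n::finite"
  assumes p: "1 < p" and \<alpha>: "0 \<le> \<alpha>" and x: "x \<noteq> 0" "norm x \<le> R"
    and g: "0 \<le> g" and A: "\<bar>A\<bar> \<le> D * g powr (1 / p)" and D: "0 \<le> D"
  shows "v * A \<le> norm x powr (- \<alpha>) * \<bar>v\<bar> powr p * g + D powr (p / (p - 1)) * R powr (\<alpha> / (p - 1))"
proof -
  define a where "a = \<bar>v\<bar> * g powr (1 / p) * norm x powr (- \<alpha> / p)"
  define b where "b = D * norm x powr (\<alpha> / p)"
  have "v * A \<le> \<bar>v\<bar> * (D * g powr (1 / p))"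
    by (rule order.trans[OF abs_ge_self]) (use A in \<open>simp add: abs_mult mult_left_mono\<close>)
  also have "\<dots> = a * b"
    using x by (simp add: a_def b_def powr_minus field_simps)
  also have "\<dots> \<le> a powr p + b powr (p / (p - 1))"
    using p g D by (intro mult_le_powr_add_powr) (auto simp: a_def b_def)
  also have "a powr p = norm x powr (- \<alpha>) * \<bar>v\<bar> powr p * g"
    using p g by (simp add: a_def powr_mult powr_powr)
  also have "b powr (p / (p - 1)) = D powr (p / (p - 1)) * norm x powr (\<alpha> / (p - 1))"
    using p D by (simp add: b_def powr_mult powr_powr)
  also have "norm x powr (\<alpha> / (p - 1)) \<le> R powr (\<alpha> / (p - 1))"
    using p \<alpha> x by (intro powr_mono2) auto
  finally show ?thesis
    by (simp add: mult_left_mono)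
qed

text \<open>Here \<open>y\<close> stands for a time placed on an axis. With parameter
  \<open>r\<^sup>2\<close> in time and \<open>r\<close> in space, one time derivative and the
  Laplacian both gain \<open>r\<close>, while the second time derivative gains
  \<open>r\<^sup>2 \<le> r\<close>. The powers of the two cutoffs multiply to the power of their
  product.\<close>

lemma test_operator_bound:
  assumes p: "1 < p"
  shows "\<exists>L>0. \<forall>r. 0 \<le> r \<longrightarrow> r \<le> 1 \<longrightarrow> (\<forall>(x::real^'n::finite) (y::real^'n) i.
    \<bar>partial_deriv i (partial_deriv i (bump (r\<^sup>2) 0)) y * bump r 0 x
      - bump (r\<^sup>2) 0 y * laplacian (bump r 0) x
      - partial_deriv i (bump (r\<^sup>2) 0) y * bump r 0 x\<bar>
    \<le> L * r * (bump (r\<^sup>2) 0 y * bump r 0 x) powr (1 / p))"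
proof -
  obtain K where K: "0 < K"
    and k0: "\<And>r (x::real^'n). r \<ge> 0 \<Longrightarrow> bump r 0 x \<le> K * bump r 0 x powr (1 / p)"
    and k1: "\<And>r (x::real^'n) i. r \<ge> 0 \<Longrightarrow>
      \<bar>partial_deriv i (bump r 0) x\<bar> \<le> K * sqrt r * bump r 0 x powr (1 / p)"
    and k2: "\<And>r (x::real^'n) i. r \<ge> 0 \<Longrightarrow>
      \<bar>partial_deriv i (partial_deriv i (bump r 0)) x\<bar> \<le> K * r * bump r 0 x powr (1 / p)"
    using bump_derivs_le_powr[OF p] by metis
  show ?thesis
  \<comment> \<open>The dimension counts the summands of the Laplacian, and 2 counts the two terms
    with time derivatives.\<close>
  proof (intro exI[of _ "K\<^sup>2 * (real CARD('n) + 2)"] conjI allI impI)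
    fix r :: real and x y :: "real^'n" and i :: 'n
    assume r: "0 \<le> r" "r \<le> 1"
    let ?X = "bump r 0 x powr (1 / p)" and ?Y = "bump (r\<^sup>2) 0 y powr (1 / p)"
    have X: "\<bar>bump r 0 x\<bar> \<le> K * ?X" and Y: "\<bar>bump (r\<^sup>2) 0 y\<bar> \<le> K * ?Y"
      using k0 r by (simp_all add: bump_nonneg)
    have "\<bar>laplacian (bump r 0) x\<bar> \<le> (\<Sum>i\<in>(UNIV::'n set). K * r * ?X)"
      unfolding laplacian_def by (rule order.trans[OF sum_abs]) (intro sum_mono k2 r)
    then have lap: "\<bar>laplacian (bump r 0) x\<bar> \<le> real CARD('n) * (K * r * ?X)"
      by simp
    have "r\<^sup>2 \<le> r"
      using r by (simp add: power2_eq_square mult_left_le)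
    then have "K * r\<^sup>2 * ?Y \<le> K * r * ?Y"
      using K by (intro mult_right_mono mult_left_mono) auto
    then have t2: "\<bar>partial_deriv i (partial_deriv i (bump (r\<^sup>2) 0)) y\<bar> \<le> K * r * ?Y"
      using k2[of "r\<^sup>2" i y] by simp
    have t1: "\<bar>partial_deriv i (bump (r\<^sup>2) 0) y\<bar> \<le> K * r * ?Y"
      using k1[of "r\<^sup>2" i y] r by simp
    have "\<bar>partial_deriv i (partial_deriv i (bump (r\<^sup>2) 0)) y * bump r 0 x\<bar> \<le> (K * r * ?Y) * (K * ?X)"
      unfolding abs_mult using K r by (intro mult_mono t2 X) auto
    moreover have "\<bar>partial_deriv i (bump (r\<^sup>2) 0) y * bump r 0 x\<bar> \<le> (K * r * ?Y) * (K * ?X)"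
      unfolding abs_mult using K r by (intro mult_mono t1 X) auto
    moreover have "\<bar>bump (r\<^sup>2) 0 y * laplacian (bump r 0) x\<bar> \<le> (K * ?Y) * (real CARD('n) * (K * r * ?X))"
      unfolding abs_mult using K r by (intro mult_mono lap Y) auto
    moreover have "\<bar>a - b - c\<bar> \<le> \<bar>a\<bar> + \<bar>b\<bar> + \<bar>c\<bar>" for a b c :: real
      by linarith
    ultimately have "\<bar>partial_deriv i (partial_deriv i (bump (r\<^sup>2) 0)) y * bump r 0 x
      - bump (r\<^sup>2) 0 y * laplacian (bump r 0) x
      - partial_deriv i (bump (r\<^sup>2) 0) y * bump r 0 x\<bar>
      \<le> (K * r * ?Y) * (K * ?X) + (K * ?Y) * (real CARD('n) * (K * r * ?X)) + (K * r * ?Y) * (K * ?X)"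
      by (smt (verit, best))
    also have "\<dots> = K\<^sup>2 * (real CARD('n) + 2) * r * (?Y * ?X)"
      by (simp add: algebra_simps power2_eq_square)
    also have "?Y * ?X = (bump (r\<^sup>2) 0 y * bump r 0 x) powr (1 / p)"
      by (simp add: powr_mult bump_nonneg)
    finally show "\<bar>partial_deriv i (partial_deriv i (bump (r\<^sup>2) 0)) y * bump r 0 x
      - bump (r\<^sup>2) 0 y * laplacian (bump r 0) x
      - partial_deriv i (bump (r\<^sup>2) 0) y * bump r 0 x\<bar>
      \<le> K\<^sup>2 * (real CARD('n) + 2) * r * (bump (r\<^sup>2) 0 y * bump r 0 x) powr (1 / p)" .
  qed (use K in \<open>auto intro!: mult_pos_pos add_nonneg_pos\<close>)
qed

section \<open>Upper bound for the data integral\<close>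

text \<open>The weak formulation makes the data term equal to the linear minus the source integral.
  Weighted Young with \<open>D = L / R\<^sup>2\<close> bounds the integrand of this difference;
  \<open>R ^ CARD('n)\<close> comes from the volume of the ball and the last
  \<open>R\<^sup>2\<close> from the length of the time interval. The factor \<open>exp (- 1)\<close>
  is the time cutoff at 0.\<close>

lemma weak_solution_data_bound:
  fixes u0 u1 :: "real^'n::finite \<Rightarrow> real"
  assumes sol: "weak_solution p \<alpha> \<infinity> \<epsilon> u0 u1 u" and p: "1 < p" and \<alpha>: "0 \<le> \<alpha>"
  shows "\<exists>L>0. \<forall>R\<ge>1.
    integrable lebesgue (\<lambda>x. (u0 x + u1 x) * bump (1 / R\<^sup>2) 0 x) \<and>
    \<epsilon> * exp (- 1) * (LINT x|lebesgue. (u0 x + u1 x) * bump (1 / R\<^sup>2) 0 x)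
      \<le> L * (1 / R\<^sup>2) powr (p / (p - 1)) * R powr (\<alpha> / (p - 1)) * R ^ CARD('n) * R\<^sup>2"
proof -
  obtain L where L: "0 < L" and A_le:
    "\<And>r (x::real^'n) (y::real^'n) i. 0 \<le> r \<Longrightarrow> r \<le> 1 \<Longrightarrow>
    \<bar>partial_deriv i (partial_deriv i (bump (r\<^sup>2) 0)) y * bump r 0 x
      - bump (r\<^sup>2) 0 y * laplacian (bump r 0) x
      - partial_deriv i (bump (r\<^sup>2) 0) y * bump r 0 x\<bar>
    \<le> L * r * (bump (r\<^sup>2) 0 y * bump r 0 x) powr (1 / p)"
    using test_operator_bound[OF p, where ?'n = 'n] by metis
  let ?V = "unit_ball_vol (real CARD('n))"
  have bound: "integrable lebesgue (\<lambda>x. (u0 x + u1 x) * bump (1 / R\<^sup>2) 0 x) \<and>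
    \<epsilon> * exp (- 1) * (LINT x|lebesgue. (u0 x + u1 x) * bump (1 / R\<^sup>2) 0 x)
      \<le> L powr (p / (p - 1)) * ?V * (1 / R\<^sup>2) powr (p / (p - 1)) * R powr (\<alpha> / (p - 1)) * R ^ CARD('n) * R\<^sup>2"
    if R: "1 \<le> R" for R
  proof -
    \<comment> \<open>Parabolic scaling: \<open>\<phi>\<close> is supported in \<open>|x| \<le> R\<close> and \<open>\<eta>\<close> in \<open>t \<le> R\<^sup>2\<close>.\<close>
    define r where "r = 1 / R\<^sup>2"
    have r: "0 < r" "r \<le> 1" and R0: "0 < R"
      using R by (auto simp: r_def)
    \<comment> \<open>Any coordinate axis serves to carry the time variable.\<close>
    define i :: 'n where "i = undefined"
    define \<phi> where "\<phi> = (bump r 0 :: real^'n \<Rightarrow> real)"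
    define \<psi> where "\<psi> = (bump (r\<^sup>2) 0 :: real^'n \<Rightarrow> real)"
    define \<eta> where "\<eta> t = \<psi> (t *\<^sub>R axis i 1)" for t :: real
    define \<eta>1 where "\<eta>1 t = partial_deriv i \<psi> (t *\<^sub>R axis i 1)" for t :: real
    define \<eta>2 where "\<eta>2 t = partial_deriv i (partial_deriv i \<psi>) (t *\<^sub>R axis i 1)" for t :: real
    have smooth: "smooth \<psi>"
      by (simp add: \<psi>_def smooth_bump)
    have d1: "time_deriv \<infinity> \<eta> t = \<eta>1 t" if "0 \<le> t" for t
      using time_deriv_iter_line(1)[OF smooth that, of 1 i]
      by (simp add: \<eta>1_def \<eta>_def[abs_def] iter_partial_Cons iter_partial_Nil)
    have d2: "time_deriv \<infinity> (time_deriv \<infinity> \<eta>) t = \<eta>2 t" if "0 \<le> t" for t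
      using time_deriv_iter_line(1)[OF smooth that, of 2 i]
      by (simp add: \<eta>2_def \<eta>_def[abs_def] iter_partial_Cons iter_partial_Nil numeral_2_eq_2)
    define A where "A t x = \<eta>2 t * \<phi> x - \<eta> t * laplacian \<phi> x - \<eta>1 t * \<phi> x" for t x
    have A: "\<bar>A t x\<bar> \<le> L * r * (\<eta> t * \<phi> x) powr (1 / p)" for t x
      using A_le[of r i "t *\<^sub>R axis i 1" x] r by (simp add: A_def \<eta>_def \<eta>1_def \<eta>2_def \<phi>_def \<psi>_def)
    have \<eta>\<phi>: "0 \<le> \<eta> t * \<phi> x" for t x
      by (simp add: \<eta>_def \<phi>_def \<psi>_def bump_nonneg)
    have \<phi>0: "\<phi> x = 0" if "R < norm x" for x
    proof -
      have "R\<^sup>2 \<le> (norm x)\<^sup>2"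
        using that R by (intro power_mono) auto
      then show ?thesis
        using R0 by (auto simp: \<phi>_def r_def power2_norm_eq_inner intro!: bump_eq_0)
    qed
    have \<eta>0: "\<eta> t = 0" if "R\<^sup>2 < t" for t
    proof -
      have "1 < r * t"
        using that R0 by (simp add: r_def)
      then have "1 \<le> (r * t)\<^sup>2"
        by (simp add: power2_eq_square less_1_mult less_imp_le)
      then show ?thesis
        by (auto simp: \<eta>_def \<psi>_def power2_eq_square inner_axis_axis mult_ac intro!: bump_eq_0)
    qed
    have "time_test \<infinity> \<eta>"
      unfolding \<eta>_def[abs_def] \<psi>_def
      by (intro time_test_line smooth_bump compactly_supported_bump) (use r in simp)
    moreover have "space_test \<phi>"
      using r by (simp add: \<phi>_def space_test_bump)
    ultimately have S:
      "iter_integrable \<infinity> (\<lambda>t x. norm x powr (- \<alpha>) * \<bar>u t x\<bar> powr p * (\<eta> t * \<phi> x))"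
      "integrable lebesgue (\<lambda>x. (u0 x + u1 x) * (\<eta> 0 * \<phi> x))"
      "iter_integrable \<infinity> (\<lambda>t x. u t x *
              (time_deriv \<infinity> (time_deriv \<infinity> \<eta>) t * \<phi> x - \<eta> t * laplacian \<phi> x
                - time_deriv \<infinity> \<eta> t * \<phi> x))"
      "iter_integral \<infinity> (\<lambda>t x. norm x powr (- \<alpha>) * \<bar>u t x\<bar> powr p * (\<eta> t * \<phi> x))
        + \<epsilon> * (LINT x|lebesgue. (u0 x + u1 x) * (\<eta> 0 * \<phi> x))
        - \<epsilon> * (LINT x|lebesgue. u0 x * (time_deriv \<infinity> \<eta> 0 * \<phi> x))
        = iter_integral \<infinity> (\<lambda>t x. u t x *
              (time_deriv \<infinity> (time_deriv \<infinity> \<eta>) t * \<phi> x - \<eta> t * laplacian \<phi> x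
                - time_deriv \<infinity> \<eta> t * \<phi> x))"
      using sol unfolding weak_solution_def Let_def by blast+
    define F where "F t = (LINT x|lebesgue. norm x powr (- \<alpha>) * \<bar>u t x\<bar> powr p * (\<eta> t * \<phi> x))" for t
    define G where "G t = (LINT x|lebesgue. u t x *
              (time_deriv \<infinity> (time_deriv \<infinity> \<eta>) t * \<phi> x - \<eta> t * laplacian \<phi> x
                - time_deriv \<infinity> \<eta> t * \<phi> x))" for t
    define M where "M = (L * r) powr (p / (p - 1)) * R powr (\<alpha> / (p - 1))"
    define W where "W = measure lebesgue (cball (0::real^'n) R)"
    have M: "0 \<le> M" and W: "0 \<le> W" by (simp_all add: M_def W_def)
    have FG: "set_integrable lebesgue {0..} F" "set_integrable lebesgue {0..} G"
      using S unfolding iter_integrable_def F_def[abs_def] G_def[abs_def] time_dom_infty by auto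
    \<comment> \<open>At a fixed time, \<open>M\<close> is the constant left over by Young's
      inequality and \<open>W\<close> the volume over which it is integrated.\<close>
    have le_t: "AE t in lebesgue. t \<in> {0..} \<longrightarrow> G t - F t \<le> M * W * indicator {0..R\<^sup>2} t"
    proof -
      have "AE t in lebesgue. t \<in> {0..} \<longrightarrow>
          integrable lebesgue (\<lambda>x. norm x powr (- \<alpha>) * \<bar>u t x\<bar> powr p * (\<eta> t * \<phi> x))"
        and "AE t in lebesgue. t \<in> {0..} \<longrightarrow> integrable lebesgue (\<lambda>x. u t x *
              (time_deriv \<infinity> (time_deriv \<infinity> \<eta>) t * \<phi> x - \<eta> t * laplacian \<phi> x
                - time_deriv \<infinity> \<eta> t * \<phi> x))"
        using S unfolding iter_integrable_def time_dom_infty by auto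
      then show ?thesis
      proof eventually_elim
        case (elim t)
        show ?case
        proof
          assume t: "t \<in> {0..}"
          let ?f = "\<lambda>x. norm x powr (- \<alpha>) * \<bar>u t x\<bar> powr p * (\<eta> t * \<phi> x)"
          let ?g = "\<lambda>x. u t x * A t x"
          have int: "integrable lebesgue ?f" "integrable lebesgue ?g"
            using elim t d1 d2 by (auto simp: A_def)
          have Gt: "G t = (LINT x|lebesgue. ?g x)"
            using t d1 d2 by (simp add: G_def A_def)
          show "G t - F t \<le> M * W * indicator {0..R\<^sup>2} t"
          proof (cases "t \<le> R\<^sup>2")
            case True
            have ind: "integrable lebesgue (\<lambda>x::real^'n. M * indicator (cball 0 R) x)"
              by (intro integrable_mult_right integrable_real_indicator) (auto simp: emeasure_lborel_cball_finite[unfolded infinity_ennreal_def])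
            have "AE x in lebesgue. x \<noteq> (0::real^'n)"
              by (intro AE_completion AE_lborel_singleton)
            then have "AE x in lebesgue. ?g x \<le> ?f x + M * indicator (cball 0 R) x"
            proof eventually_elim
              case (elim x)
              show ?case
              proof (cases "norm x \<le> R")
                case True
                then show ?thesis
                  using weighted_young[OF p \<alpha> elim True \<eta>\<phi> A] L r by (simp add: M_def)
              next
                case False
                \<comment> \<open>Where the cutoff is zero, so is its \<open>1 / p\<close>-th power,
                  and the bound \<open>A\<close> forces the linear integrand to vanish along with
                  the source.\<close>
                then show ?thesis
                  using A[of t x] p by (simp add: \<phi>0)
              qed
            qed
            then have "(LINT x|lebesgue. ?g x) \<le> (LINT x|lebesgue. ?f x + M * indicator (cball 0 R) x)"
              using int ind by (intro integral_mono_AE integrable_add) auto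
            also have "\<dots> = F t + M * W"
              using int ind by (subst Bochner_Integration.integral_add) (auto simp: F_def W_def)
            finally show ?thesis
              using True t by (simp add: Gt)
          next
            case False
            then have "\<eta> t = 0" by (simp add: \<eta>0)
            then have "?f = (\<lambda>x. 0)" "?g = (\<lambda>x. 0)"
              using A[of t] p by auto
            then show ?thesis
              using False unfolding Gt F_def by simp
          qed
        qed
      qed
    qed
    have ind: "set_integrable lebesgue {0..} (\<lambda>t. M * W * indicator {0..R\<^sup>2} t)"
    proof -
      have "integrable lebesgue (\<lambda>t::real. M * W * indicator {0..R\<^sup>2} t)"
        by (intro integrable_mult_right integrable_real_indicator) auto
      moreover have "(\<lambda>t. indicator {0..} t *\<^sub>R (M * W * indicator {0..R\<^sup>2} t)) = (\<lambda>t. M * W * indicator {0..R\<^sup>2} t)"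
        by (auto simp: indicator_def fun_eq_iff)
      ultimately show ?thesis
        unfolding set_integrable_def by simp
    qed
    have "(LINT t:{0..}|lebesgue. G t - F t) \<le> (LINT t:{0..}|lebesgue. M * W * indicator {0..R\<^sup>2} t)"
      using le_t by (intro set_integral_mono_AE set_integral_diff FG ind) auto
    also have "\<dots> = (LINT t|lebesgue. M * W * indicator {0..R\<^sup>2} t)"
      unfolding set_lebesgue_integral_def
      by (intro Bochner_Integration.integral_cong) (auto simp: indicator_def)
    also have "\<dots> = M * W * R\<^sup>2"
      by simp
    also have "(LINT t:{0..}|lebesgue. G t - F t)
        = (LINT t:{0..}|lebesgue. G t) - (LINT t:{0..}|lebesgue. F t)"
      by (intro set_integral_diff FG)
    finally have GF: "iter_integral \<infinity> (\<lambda>t x. u t x *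
              (time_deriv \<infinity> (time_deriv \<infinity> \<eta>) t * \<phi> x - \<eta> t * laplacian \<phi> x
                - time_deriv \<infinity> \<eta> t * \<phi> x))
        - iter_integral \<infinity> (\<lambda>t x. norm x powr (- \<alpha>) * \<bar>u t x\<bar> powr p * (\<eta> t * \<phi> x)) \<le> M * W * R\<^sup>2"
      by (simp add: iter_integral_def time_dom_infty F_def G_def)
    \<comment> \<open>The cutoff depends on time through its square, so its derivative vanishes at
      0. This removes the separate \<open>u0\<close> term and leaves only the sum of the
      data.\<close>
    have "time_deriv \<infinity> \<eta> 0 = 0"
      by (simp add: d1 \<eta>1_def \<psi>_def partial_deriv_bump)
    moreover have e1: "\<eta> 0 = exp (- 1)"
      by (simp add: \<eta>_def \<psi>_def bump_def flat_exp_def)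
    ultimately have "\<epsilon> * (LINT x|lebesgue. exp (- 1) * ((u0 x + u1 x) * \<phi> x)) \<le> M * W * R\<^sup>2"
      using S(4) GF by (simp add: mult_ac)
    moreover have "M * W = L powr (p / (p - 1)) * ?V * r powr (p / (p - 1)) * R powr (\<alpha> / (p - 1)) * R ^ CARD('n)"
      using L r R0 by (simp add: M_def W_def content_cball powr_mult)
    moreover have "integrable lebesgue (\<lambda>x. exp (- 1) * ((u0 x + u1 x) * \<phi> x))"
      using S(2) by (simp add: e1 mult_ac)
    then have "integrable lebesgue (\<lambda>x. (u0 x + u1 x) * \<phi> x)"
      by simp
    ultimately show ?thesis
      by (simp add: \<phi>_def r_def mult_ac)
  qed
  show ?thesis
    by (rule exI[of _ "L powr (p / (p - 1)) * ?V"]) (use bound L in auto)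
qed

section \<open>Lower bound for the data integral\<close>

lemma bump_ge_half_ball:
  assumes "0 < R" "norm x \<le> R / 2"
  shows "exp (- 2) \<le> bump (1 / R\<^sup>2) 0 x"
proof -
  have "(norm x)\<^sup>2 \<le> (R / 2)\<^sup>2"
    using assms by (intro power_mono) auto
  then have "1 / 2 \<le> 1 - 1 / R\<^sup>2 * (x \<bullet> x)"
    using assms inner_ge_zero[of x]
    by (simp add: power2_norm_eq_inner power_divide field_simps del: inner_ge_zero)
  moreover have "exp (- 2) \<le> flat_exp 0 y" if "1 / 2 \<le> y" for y :: real
    using that by (simp add: flat_exp_def divide_le_eq)
  ultimately show ?thesis
    unfolding bump_def by blast
qed

text \<open>The integrand is nonnegative, so the integral may be restricted to the ball of radius
  \<open>R / 2\<close>. There the bump is at least \<open>exp (- 2)\<close> and the decreasing lower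
  profile is at least its value at radius \<open>R\<close>.\<close>

lemma slowly_decaying_data_integral_ge:
  fixes w :: "real^'n::finite \<Rightarrow> real"
  assumes w: "\<And>x. c * japanese x powr (- s) * inverse (ln (exp 1 + norm x)) \<le> w x"
    and c: "0 < c" and s: "0 \<le> s" and R: "1 \<le> R"
    and int: "integrable lebesgue (\<lambda>x. w x * bump (1 / R\<^sup>2) 0 x)"
  shows "c * sqrt (1 + R\<^sup>2) powr (- s) * inverse (ln (exp 1 + R)) * exp (- 2)
      * (unit_ball_vol (real CARD('n)) * (R / 2) ^ CARD('n))
    \<le> (LINT x|lebesgue. w x * bump (1 / R\<^sup>2) 0 x)"
proof -
  have ln1: "1 \<le> ln (exp 1 + norm x)" for x :: "real^'n"
    using ln_mono[of "exp 1" "exp 1 + norm x"] by (simp add: add_pos_nonneg)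
  define m where "m = c * sqrt (1 + R\<^sup>2) powr (- s) * inverse (ln (exp 1 + R)) * exp (- 2)"
  let ?B = "cball (0::real^'n) (R / 2)"
  have ptw: "m * indicator ?B x \<le> w x * bump (1 / R\<^sup>2) 0 x" for x
  proof (cases "x \<in> ?B")
    case True
    then have x: "norm x \<le> R / 2" by simp
    have "japanese x \<le> sqrt (1 + R\<^sup>2)"
      unfolding japanese_def using x R by (intro real_sqrt_le_mono add_left_mono power_mono) auto
    moreover have "0 < japanese x"
      by (simp add: japanese_def add_pos_nonneg)
    ultimately have 1: "sqrt (1 + R\<^sup>2) powr (- s) \<le> japanese x powr (- s)"
      using s by (intro powr_mono2') auto
    have 2: "inverse (ln (exp 1 + R)) \<le> inverse (ln (exp 1 + norm x))"
      using x R ln1[of x] by (intro le_imp_inverse_le ln_mono) (auto intro: add_pos_nonneg)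
    have "c * sqrt (1 + R\<^sup>2) powr (- s) * inverse (ln (exp 1 + R))
        \<le> c * japanese x powr (- s) * inverse (ln (exp 1 + norm x))"
      using c R by (intro mult_mono 1 2) (auto intro!: ln_ge_zero add_increasing)
    also have "\<dots> \<le> w x" by (rule w)
    finally have 3: "c * sqrt (1 + R\<^sup>2) powr (- s) * inverse (ln (exp 1 + R)) \<le> w x" .
    have "0 \<le> ln (exp 1 + R)"
      using R by (intro ln_ge_zero) (auto intro: add_increasing)
    then have "0 \<le> c * sqrt (1 + R\<^sup>2) powr (- s) * inverse (ln (exp 1 + R))"
      using c by auto
    with 3 have "m \<le> w x * bump (1 / R\<^sup>2) 0 x"
      unfolding m_def using R x by (intro mult_mono bump_ge_half_ball) auto
    then show ?thesis using True by simp
  next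
    case False
    have "0 \<le> c * japanese x powr (- s) * inverse (ln (exp 1 + norm x))"
      using c ln1[of x] by auto
    with w[of x] have "0 \<le> w x" by linarith
    then show ?thesis using False by (simp add: bump_nonneg)
  qed
  have "m * (unit_ball_vol (real CARD('n)) * (R / 2) ^ CARD('n)) = (LINT x|lebesgue. m * indicator ?B x)"
    using R by (simp add: content_cball)
  also have "\<dots> \<le> (LINT x|lebesgue. w x * bump (1 / R\<^sup>2) 0 x)"
    by (intro integral_mono int ptw integrable_mult_right integrable_real_indicator)
      (auto simp: emeasure_lborel_cball_finite[unfolded infinity_ennreal_def])
  finally show ?thesis by (simp add: m_def)
qed

section \<open>Comparison of the two bounds for large radii\<close>

theorem theorem1p2:
  fixes \<alpha> \<beta> c p \<epsilon> :: real
    and u0 u1 :: "real^'n::finite \<Rightarrow> real"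
  assumes "0 \<le> \<alpha>" and "\<alpha> < 2"
    and "0 \<le> \<beta>" and "\<beta> < real CARD('n) / 2"
    and "fun_in_hom_sobolev_neg \<beta> u0" and "fun_in_hom_sobolev_neg \<beta> u1"
    and "c > 0"
    and "\<And>x. u0 x + u1 x \<ge>
           c * japanese x powr (- (real CARD('n) * (1 / 2 + \<beta> / real CARD('n))))
             * inverse (ln (exp 1 + norm x))"
    and "1 < p" and "p < p_crit \<alpha> \<beta> CARD('n)"
    and "\<epsilon> > 0"
  shows "\<not> (\<exists>u. weak_solution p \<alpha> \<infinity> \<epsilon> u0 u1 u)"
proof
  define n where "n = CARD('n)"
  define V where "V = unit_ball_vol (real n)"
  \<comment> \<open>After division by \<open>R ^ n\<close> the lower bound behaves like
    \<open>R powr (- s)\<close> over a logarithm and the upper one like \<open>R powr (- q)\<close>.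
    Subcriticality of \<open>p\<close> amounts to \<open>s < q\<close>.\<close>
  define s where "s = real n * (1 / 2 + \<beta> / real n)"
  define q where "q = (2 - \<alpha>) / (p - 1)"
  have n: "0 < n" by (simp add: n_def)
  have V: "0 < V" by (simp add: V_def)
  have s: "0 \<le> s" using assms by (simp add: s_def)
  have s2: "2 * s = real n + 2 * \<beta>"
    using n by (simp add: s_def field_simps)
  have "p - 1 < (4 - 2 * \<alpha>) / (2 * s)"
    using assms(10) by (simp add: p_crit_def s2 n_def)
  moreover have "0 < 2 * s"
    using n assms(3) by (simp add: s2)
  ultimately have "(p - 1) * (2 * s) < 4 - 2 * \<alpha>"
    by (simp add: less_divide_eq)
  then have sq: "s < q"
    using assms(9) by (simp add: q_def less_divide_eq algebra_simps)
  assume "\<exists>u. weak_solution p \<alpha> \<infinity> \<epsilon> u0 u1 u"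
  then obtain u where u: "weak_solution p \<alpha> \<infinity> \<epsilon> u0 u1 u" ..
  obtain L where L: "0 < L" and data: "\<forall>R\<ge>1.
      integrable lebesgue (\<lambda>x. (u0 x + u1 x) * bump (1 / R\<^sup>2) 0 x) \<and>
      \<epsilon> * exp (- 1) * (LINT x|lebesgue. (u0 x + u1 x) * bump (1 / R\<^sup>2) 0 x)
        \<le> L * (1 / R\<^sup>2) powr (p / (p - 1)) * R powr (\<alpha> / (p - 1)) * R ^ n * R\<^sup>2"
    using weak_solution_data_bound[OF u assms(9,1)] unfolding n_def by (elim exE conjE)
  have int: "integrable lebesgue (\<lambda>x. (u0 x + u1 x) * bump (1 / R\<^sup>2) 0 x)"
    and le: "\<epsilon> * exp (- 1) * (LINT x|lebesgue. (u0 x + u1 x) * bump (1 / R\<^sup>2) 0 x)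
      \<le> L * (1 / R\<^sup>2) powr (p / (p - 1)) * R powr (\<alpha> / (p - 1)) * R ^ n * R\<^sup>2"
    if "1 \<le> R" for R
    using data that by auto
  \<comment> \<open>Collects the constants of the lower bound: the time cutoff at 0, the bump on the
    half ball, and the volume of that ball without \<open>R ^ n\<close>.\<close>
  define a where "a = \<epsilon> * exp (- 1) * c * exp (- 2) * V / 2 ^ n"
  have a: "0 < a" using V assms by (simp add: a_def)
  \<comment> \<open>The factor \<open>2 powr s\<close> pays for replacing
    \<open>sqrt (1 + R\<^sup>2)\<close> by \<open>2 * R\<close>.\<close>
  define C where "C = L / a * 2 powr s"
  have key: "1 \<le> C * (R powr (s - q) * ln (exp 1 + R))" if R: "1 \<le> R" for R
  proof -
    have lnpos: "0 < ln (exp 1 + R)"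
      using R by (intro ln_gt_zero) (auto intro: add_strict_increasing)
    define J where "J = sqrt (1 + R\<^sup>2)"
    have J0: "0 < J" by (simp add: J_def add_pos_nonneg)
    have "1 + R\<^sup>2 \<le> 4 * R\<^sup>2"
      using one_le_power[OF R, of 2] by linarith
    then have "1 + R\<^sup>2 \<le> (2 * R)\<^sup>2"
      by (simp add: power_mult_distrib)
    then have J: "J \<le> 2 * R"
      using R by (simp add: J_def real_le_lsqrt)
    have "c * J powr (- s) * inverse (ln (exp 1 + R)) * exp (- 2) * (V * (R / 2) ^ n)
        \<le> (LINT x|lebesgue. (u0 x + u1 x) * bump (1 / R\<^sup>2) 0 x)"
      using slowly_decaying_data_integral_ge[OF assms(8,7) s[unfolded s_def n_def] R int[OF R]]
      by (simp add: J_def V_def n_def s_def)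
    then have "\<epsilon> * exp (- 1) * (c * J powr (- s) * inverse (ln (exp 1 + R)) * exp (- 2) * (V * (R / 2) ^ n))
        \<le> L * (1 / R\<^sup>2) powr (p / (p - 1)) * R powr (\<alpha> / (p - 1)) * R ^ n * R\<^sup>2"
      using assms(11) by (intro order.trans[OF mult_left_mono le[OF R]]) auto
    then have "R ^ n * (a * (J powr (- s) * inverse (ln (exp 1 + R))))
        \<le> R ^ n * (L * ((1 / R\<^sup>2) powr (p / (p - 1)) * R powr (\<alpha> / (p - 1)) * R\<^sup>2))"
      by (simp add: a_def power_divide mult_ac)
    then have "a * (J powr (- s) * inverse (ln (exp 1 + R)))
        \<le> L * ((1 / R\<^sup>2) powr (p / (p - 1)) * R powr (\<alpha> / (p - 1)) * R\<^sup>2)"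
      using R by (simp add: mult_le_cancel_left_pos)
    also have "(1 / R\<^sup>2) powr (p / (p - 1)) * R powr (\<alpha> / (p - 1)) * R\<^sup>2 = R powr (- q)"
    proof -
      have "1 / R\<^sup>2 = R powr (- 2)" "R\<^sup>2 = R powr 2"
        using R by (simp_all add: powr_minus field_simps powr_numeral)
      then have "(1 / R\<^sup>2) powr (p / (p - 1)) * R powr (\<alpha> / (p - 1)) * R\<^sup>2
          = R powr (- 2 * (p / (p - 1)) + \<alpha> / (p - 1) + 2)"
        by (simp only: powr_powr powr_add)
      also have "- 2 * (p / (p - 1)) + \<alpha> / (p - 1) + 2 = - q"
      proof -
        have "p / (p - 1) = 1 + 1 / (p - 1)"
          using assms(9) by (simp add: field_simps)
        then show ?thesis
          by (simp add: q_def diff_divide_distrib)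
      qed
      finally show ?thesis .
    qed
    finally have "a * (J powr (- s) * inverse (ln (exp 1 + R))) * (J powr s * ln (exp 1 + R))
        \<le> L * R powr (- q) * (J powr s * ln (exp 1 + R))"
      using lnpos by (intro mult_right_mono) auto
    also have "a * (J powr (- s) * inverse (ln (exp 1 + R))) * (J powr s * ln (exp 1 + R)) = a"
      using lnpos J0 by (simp add: powr_minus field_simps)
    also have "L * R powr (- q) * (J powr s * ln (exp 1 + R))
        \<le> L * R powr (- q) * ((2 * R) powr s * ln (exp 1 + R))"
      using L lnpos J J0 s by (intro mult_left_mono mult_right_mono powr_mono2) auto
    also have "\<dots> = a * (C * (R powr (s - q) * ln (exp 1 + R)))"
      using a R by (simp add: C_def powr_mult powr_diff powr_minus field_simps)
    finally show ?thesis
      using a by simp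
  qed
  \<comment> \<open>A negative power beats the logarithm, so the right side of \<open>key\<close>
    falls below 1 for large \<open>R\<close>.\<close>
  have "((\<lambda>R. C * (R powr (s - q) * ln (exp 1 + R))) \<longlongrightarrow> C * 0) at_top"
  proof (intro tendsto_mult tendsto_const)
    have "s - q < 0" using sq by simp
    then show "((\<lambda>R. R powr (s - q) * ln (exp 1 + R)) \<longlongrightarrow> 0) at_top"
      by real_asymp
  qed
  then have "\<forall>\<^sub>F R in at_top. C * (R powr (s - q) * ln (exp 1 + R)) < 1"
    by (intro order_tendstoD(2)[where y = "C * 0"]) auto
  then obtain R where "1 \<le> R" "C * (R powr (s - q) * ln (exp 1 + R)) < 1"
    using eventually_happens[OF eventually_conj[OF _ eventually_ge_at_top[of 1]]] by auto
  then show False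
    using key[of R] by simp
qed

end
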